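(* If the evaluation distribution $F$ is a regular distribution, i.e. $\lambda\mapsto\lambda\bar F^{-1}(\lambda/\Lambda)$ is a continuous concave function on $[0,\Lambda]$, then $$g^*-g_T^*\le\begin{cases}\left(\tilde{\mathcal R}_s-\tilde{\mathcal R}_q\right)P_q^T+\tilde{\mathcal R}_sP_N^T&\text{when }\mathcal C_s\le\mathcal C_q,\\[4pt]\left(\tilde{\mathcal R}_q-\tilde{\mathcal R}_s\right)\left(P_q^\Lambda-P_q^T\right)+\tilde\delta_q(\mathcal C_s-\mathcal C_q)P_q^T+\tilde{\mathcal R}_sP_N^T&\text{when }\mathcal C_s\ge\mathcal C_q.\end{cases}$$
   Context: Model: a Markovian queue with $m$ servers, capacity $N$, maximal arrival rate $\Lambda$, service rate $\mu$, abandonment rates $\theta_s$ (in service) and $\theta_q$ (waiting), holding cost $c_h$, abandonment costs $c_s$ (in service) and $c_q$ (waiting). The parameters are integers $1\le m\le N<\infty$ and reals $\Lambda>0$, $\mu>0$, $\theta_q>0$, $\theta_s\ge 0$, $c_h,c_q,c_s\ge 0$, $0\le a<b<\infty$. $F$ is a continuous cumulative distribution function supported on $[a,b]$ ($F(a)=0$, $F(b)=1$) with a positive density on $[a,b]$; $\bar F=1-F$, and for $y\in[0,1]$, $\bar F^{-1}(y)=\inf\{x\in[a,b]:\bar F(x)\le y\}$. For integers $n\ge0$: $\gamma_n=\min\{n,m\}(\mu+\theta_s)+\max\{n-m,0\}\theta_q$ and $r_n(\lambda)=\lambda\bar F^{-1}(\lambda/\Lambda)-nc_h-\min\{n,m\}c_s\theta_s-\max\{n-m,0\}c_q\theta_q$.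 Set $\mathcal C_s=\frac{c_h+c_s\theta_s}{\mu+\theta_s}$, $\mathcal C_q=\frac{c_h}{\theta_q}+c_q$. An arrival rate policy is $\vec\lambda\in\Pi=[0,\Lambda]^N\times\{0\}$; its steady-state probabilities are $P_n(\vec\lambda)=a_n(\vec\lambda)/\sum_{i=0}^Na_i(\vec\lambda)$ with $a_0(\vec\lambda)=1$, $a_n(\vec\lambda)=\prod_{i=1}^n\lambda_{i-1}/\gamma_i$, and its long-run average gain is $g^{\vec\lambda}=\sum_{n=0}^Nr_n(\lambda_n)P_n(\vec\lambda)$. The optimal dynamic gain is $g^*=\max_{\vec\lambda\in\Pi}g^{\vec\lambda}$. Two-price policy: for $K\in\{m,\ldots,N\}$ and $\delta_s,\delta_q\in[0,\Lambda]$, $\pi_K^{\delta_s,\delta_q}\in\Pi$ has arrival rate $\delta_s$ in states $0\le n<m$, $\delta_q$ in states $m\le n<K$, and $0$ in states $K\le n\le N$. Its gain is $g_T^{\delta_s,\delta_q}(K)$, and the gain of the best two-price policy is $g_T^*=\max_{K=m,\ldots,N}\max_{(\delta_s,\delta_q)\in[0,\Lambda]^2}g_T^{\delta_s,\delta_q}(K)$. For $x\in\{s,q\}$: $\tilde{\mathcal R}_x=\max_{\lambda\in[0,\Lambda]}\{\lambda\bar F^{-1}(\lambda/\Lambda)-\lambda\mathcal C_x\}$ and $\tilde\delta_x=\inf(\arg\max_{\lambda\in[0,\Lambda]}\{\lambda\bar F^{-1}(\lambda/\Lambda)-\lambda\mathcal C_x\})$. Also $P_q^T=\sum_{n=m}^{N-1}P_n(\pi_N^{\tilde\delta_s,\tilde\delta_q})$,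 $P_N^T=P_N(\pi_N^{\tilde\delta_s,\tilde\delta_q})$, and $$P_q^\Lambda=\frac{\sum_{n=m}^\infty a_n(\Lambda)}{\sum_{n=0}^\infty a_n(\Lambda)},\qquad a_n(\Lambda)=\prod_{i=1}^n\frac{\Lambda}{\gamma_i}\ (n\ge0),$$ where the series converge since $\theta_q>0$. *)

theory Defs
  imports "HOL-Probability.Probability"
begin

text \<open>\<open>eval_cdf\<close> is the evaluation distribution \<open>F\<close>, supported on \<open>[eval_lo, eval_hi] = [a, b]\<close>.\<close>

record queue =
  servers :: nat             (* m *)
  capacity :: nat            (* N *)
  max_rate :: real           (* Lambda *)
  service_rate :: real       (* mu *)
  abandon_s :: real          (* theta_s *)
  abandon_q :: real          (* theta_q *)
  hold_cost :: real          (* c_h *)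
  abandon_cost_s :: real     (* c_s *)
  abandon_cost_q :: real     (* c_q *)
  eval_lo :: real            (* a *)
  eval_hi :: real            (* b *)
  eval_cdf :: "real \<Rightarrow> real"  (* F *)

definition has_positive_density_on :: "real \<Rightarrow> real \<Rightarrow> (real \<Rightarrow> real) \<Rightarrow> bool" where
  "has_positive_density_on a b F \<longleftrightarrow>
     (\<exists>f. f \<in> borel_measurable borel \<and> (\<forall>x\<in>{a..b}. 0 < f x) \<and> (\<forall>x. x \<notin> {a..b} \<longrightarrow> f x = 0) \<and>
          prob_space (density lborel (\<lambda>x. ennreal (f x))) \<and>
          F = cdf (density lborel (\<lambda>x. ennreal (f x))))"

definition valid_queue :: "queue \<Rightarrow> bool" where
  "valid_queue Q \<longleftrightarrow>
     1 \<le> servers Q \<and> servers Q \<le> capacity Q \<and>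
     0 < max_rate Q \<and> 0 < service_rate Q \<and> 0 < abandon_q Q \<and> 0 \<le> abandon_s Q \<and>
     0 \<le> hold_cost Q \<and> 0 \<le> abandon_cost_q Q \<and> 0 \<le> abandon_cost_s Q \<and>
     0 \<le> eval_lo Q \<and> eval_lo Q < eval_hi Q \<and>
     continuous_on UNIV (eval_cdf Q) \<and> eval_cdf Q (eval_lo Q) = 0 \<and> eval_cdf Q (eval_hi Q) = 1 \<and>
     has_positive_density_on (eval_lo Q) (eval_hi Q) (eval_cdf Q)"

definition inv_tail :: "queue \<Rightarrow> real \<Rightarrow> real" where
  "inv_tail Q y = Inf {x \<in> {eval_lo Q..eval_hi Q}. 1 - eval_cdf Q x \<le> y}"

definition revenue :: "queue \<Rightarrow> real \<Rightarrow> real" where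
  "revenue Q l = l * inv_tail Q (l / max_rate Q)"

definition regular_evaluation :: "queue \<Rightarrow> bool" where
  "regular_evaluation Q \<longleftrightarrow>
     continuous_on {0..max_rate Q} (revenue Q) \<and> concave_on {0..max_rate Q} (revenue Q)"

text \<open>Naturals subtract with truncation, so \<open>n - m\<close> below is \<open>max {n - m, 0}\<close>.\<close>

definition departure_rate :: "queue \<Rightarrow> nat \<Rightarrow> real" where
  "departure_rate Q n =
     real (min n (servers Q)) * (service_rate Q + abandon_s Q) + real (n - servers Q) * abandon_q Q"

definition gain_rate :: "queue \<Rightarrow> nat \<Rightarrow> real \<Rightarrow> real" where
  "gain_rate Q n l =
     revenue Q l - real n * hold_cost Q
       - real (min n (servers Q)) * abandon_cost_s Q * abandon_s Q
       - real (n - servers Q) * abandon_cost_q Q * abandon_q Q"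

definition cost_s :: "queue \<Rightarrow> real" where
  "cost_s Q = (hold_cost Q + abandon_cost_s Q * abandon_s Q) / (service_rate Q + abandon_s Q)"

definition cost_q :: "queue \<Rightarrow> real" where
  "cost_q Q = hold_cost Q / abandon_q Q + abandon_cost_q Q"

text \<open>A policy is an element of \<open>[0, \<Lambda>]\<^sup>N \<times> {0}\<close>, encoded as a sequence that is zero from
  position \<open>N\<close> on.\<close>

definition policies :: "queue \<Rightarrow> (nat \<Rightarrow> real) set" where
  "policies Q = {l. (\<forall>n<capacity Q. l n \<in> {0..max_rate Q}) \<and> (\<forall>n\<ge>capacity Q. l n = 0)}"

definition weight :: "queue \<Rightarrow> (nat \<Rightarrow> real) \<Rightarrow> nat \<Rightarrow> real" where
  "weight Q l n = (\<Prod>i=1..n. l (i - 1) / departure_rate Q i)"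

definition steady_prob :: "queue \<Rightarrow> (nat \<Rightarrow> real) \<Rightarrow> nat \<Rightarrow> real" where
  "steady_prob Q l n = weight Q l n / (\<Sum>i=0..capacity Q. weight Q l i)"

definition gain :: "queue \<Rightarrow> (nat \<Rightarrow> real) \<Rightarrow> real" where
  "gain Q l = (\<Sum>n=0..capacity Q. gain_rate Q n (l n) * steady_prob Q l n)"

text \<open>The maxima over continua are written as suprema; lemmas at the end show that they are
  attained when the evaluation distribution is regular.\<close>

definition opt_gain :: "queue \<Rightarrow> real" where
  "opt_gain Q = (SUP l\<in>policies Q. gain Q l)"

definition two_price :: "queue \<Rightarrow> nat \<Rightarrow> real \<Rightarrow> real \<Rightarrow> nat \<Rightarrow> real" where
  "two_price Q K ds dq n = (if n < servers Q then ds else if n < K then dq else 0)"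

definition opt_two_price_gain :: "queue \<Rightarrow> real" where
  "opt_two_price_gain Q =
     (MAX K\<in>{servers Q..capacity Q}.
        SUP (ds, dq)\<in>{0..max_rate Q} \<times> {0..max_rate Q}. gain Q (two_price Q K ds dq))"

text \<open>In the next two definitions \<open>c\<close> is \<open>cost_s Q\<close> or \<open>cost_q Q\<close>.\<close>

definition R_tilde :: "queue \<Rightarrow> real \<Rightarrow> real" where
  "R_tilde Q c = (SUP l\<in>{0..max_rate Q}. revenue Q l - l * c)"

definition delta_tilde :: "queue \<Rightarrow> real \<Rightarrow> real" where
  "delta_tilde Q c =
     Inf {l. is_arg_max (\<lambda>l. revenue Q l - l * c) (\<lambda>l. l \<in> {0..max_rate Q}) l}"

definition static_policy :: "queue \<Rightarrow> nat \<Rightarrow> real" where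
  "static_policy Q =
     two_price Q (capacity Q) (delta_tilde Q (cost_s Q)) (delta_tilde Q (cost_q Q))"

definition PqT :: "queue \<Rightarrow> real" where
  "PqT Q = (\<Sum>n\<in>{servers Q..<capacity Q}. steady_prob Q (static_policy Q) n)"

definition PNT :: "queue \<Rightarrow> real" where
  "PNT Q = steady_prob Q (static_policy Q) (capacity Q)"

definition PqLambda :: "queue \<Rightarrow> real" where
  "PqLambda Q =
     (\<Sum>n. weight Q (\<lambda>_. max_rate Q) (servers Q + n)) / (\<Sum>n. weight Q (\<lambda>_. max_rate Q) n)"


lemma departure_rate_pos:
  assumes "valid_queue Q" "1 \<le> n"
  shows "departure_rate Q n > 0"
proof -
  have "real (min n (servers Q)) * (service_rate Q + abandon_s Q) > 0"
    using assms by (intro mult_pos_pos) (auto simp: valid_queue_def)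
  moreover have "real (n - servers Q) * abandon_q Q \<ge> 0"
    using assms by (auto simp: valid_queue_def)
  ultimately show ?thesis by (simp add: departure_rate_def)
qed

lemma weight_sum_pos:
  assumes "valid_queue Q" "l \<in> policies Q"
  shows "(\<Sum>i=0..capacity Q. weight Q l i) > 0"
proof (rule sum_pos2[where i = 0])
  have "l n \<ge> 0" for n
    using assms(2) by (cases "n < capacity Q") (auto simp: policies_def)
  then show "weight Q l i \<ge> 0" for i
    unfolding weight_def
    using departure_rate_pos[OF assms(1)] by (intro prod_nonneg) (auto intro!: divide_nonneg_pos)
qed (auto simp: weight_def)

lemma continuous_on_coord: "continuous_on S (\<lambda>l :: nat \<Rightarrow> real. l n)"
  by (rule continuous_on_subset[OF continuous_on_product_coordinates]) simp

lemma continuous_on_weight: "continuous_on S (\<lambda>l. weight Q l n)"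
  unfolding weight_def divide_inverse
  by (intro continuous_on_prod continuous_on_mult continuous_on_const continuous_on_coord)

lemma continuous_on_gain:
  assumes "valid_queue Q" "regular_evaluation Q"
  shows "continuous_on (policies Q) (gain Q)"
proof -
  have "continuous_on (policies Q) (\<lambda>l. revenue Q (l n))" for n
  proof (rule continuous_on_compose2[of "{0..max_rate Q}" "revenue Q"])
    show "(\<lambda>l. l n) ` policies Q \<subseteq> {0..max_rate Q}"
      using assms(1) by (cases "n < capacity Q") (auto simp: policies_def valid_queue_def)
  qed (use assms(2) in \<open>auto simp: regular_evaluation_def continuous_on_coord\<close>)
  moreover have "(\<Sum>i=0..capacity Q. weight Q l i) \<noteq> 0" if "l \<in> policies Q" for l
    using weight_sum_pos[OF assms(1) that] by simp
  ultimately show ?thesis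
    unfolding gain_def[abs_def] gain_rate_def steady_prob_def
    by (intro continuous_on_sum continuous_on_mult continuous_on_diff continuous_on_divide
        continuous_on_const continuous_on_weight) auto
qed

lemma compact_policies: "compact (policies Q)"
proof -
  define B where "B n = (if n < capacity Q then {0..max_rate Q} else {0})" for n
  have "policies Q = PiE UNIV B"
    by (force simp: policies_def B_def PiE_def Pi_def)
  moreover have "compactin (product_topology (\<lambda>i::nat. euclidean::real topology) UNIV) (PiE UNIV B)"
    by (subst compactin_PiE) (auto simp: B_def)
  ultimately show ?thesis
    by (simp add: euclidean_product_topology)
qed

lemma two_price_in_policies:
  assumes "valid_queue Q" "K \<in> {servers Q..capacity Q}"
    and "ds \<in> {0..max_rate Q}" "dq \<in> {0..max_rate Q}"
  shows "two_price Q K ds dq \<in> policies Q"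
  using assms by (auto simp: policies_def two_price_def valid_queue_def)

lemma SUP_eqI_max:
  fixes f :: "'a \<Rightarrow> real"
  assumes "x \<in> S" "\<And>y. y \<in> S \<Longrightarrow> f y \<le> f x"
  shows "(SUP y\<in>S. f y) = f x"
  using assms by (intro cSup_eq_maximum) auto

lemma opt_gain_attained:
  assumes "valid_queue Q" "regular_evaluation Q"
  shows "\<exists>l\<in>policies Q. opt_gain Q = gain Q l \<and> (\<forall>l'\<in>policies Q. gain Q l' \<le> gain Q l)"
proof -
  have "(\<lambda>_. 0) \<in> policies Q"
    using assms by (auto simp: policies_def valid_queue_def)
  then obtain l where l: "l \<in> policies Q" "\<forall>l'\<in>policies Q. gain Q l' \<le> gain Q l"
    using continuous_attains_sup[OF compact_policies _ continuous_on_gain[OF assms]] by blast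
  then show ?thesis
    unfolding opt_gain_def using SUP_eqI_max[of l "policies Q" "gain Q"] by auto
qed

lemma two_price_gain_attained:
  assumes "valid_queue Q" "regular_evaluation Q" "K \<in> {servers Q..capacity Q}"
  defines "S \<equiv> {0..max_rate Q} \<times> {0..max_rate Q}"
  shows "\<exists>(ds, dq)\<in>S. (SUP (ds, dq)\<in>S. gain Q (two_price Q K ds dq)) = gain Q (two_price Q K ds dq)
           \<and> (\<forall>(es, eq)\<in>S. gain Q (two_price Q K es eq) \<le> gain Q (two_price Q K ds dq))"
proof -
  have S: "compact S" "S \<noteq> {}"
    using assms(1) by (auto simp: S_def valid_queue_def intro!: compact_Times)
  have "continuous_on S (\<lambda>p. two_price Q K (fst p) (snd p) n)" for n
    unfolding two_price_def
    by (cases "n < servers Q"; cases "n < K") (simp_all add: continuous_on_fst continuous_on_snd)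
  then have "continuous_on S (\<lambda>p. two_price Q K (fst p) (snd p))"
    by (rule continuous_on_coordinatewise_then_product)
  moreover have "(\<lambda>p. two_price Q K (fst p) (snd p)) ` S \<subseteq> policies Q"
    using two_price_in_policies[OF assms(1,3)] by (auto simp: S_def)
  ultimately have "continuous_on S (\<lambda>p. gain Q (two_price Q K (fst p) (snd p)))"
    by (rule continuous_on_compose2[OF continuous_on_gain[OF assms(1,2)]])
  from continuous_attains_sup[OF S this] obtain p where
    p: "p \<in> S" "\<forall>q\<in>S. gain Q (two_price Q K (fst q) (snd q)) \<le> gain Q (two_price Q K (fst p) (snd p))"
    by blast
  then have "(SUP q\<in>S. gain Q (two_price Q K (fst q) (snd q))) = gain Q (two_price Q K (fst p) (snd p))"
    by (intro SUP_eqI_max) auto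
  with p show ?thesis
    by (intro bexI[of _ p]) (auto simp: case_prod_beta)
qed

lemma R_tilde_attained:
  assumes "valid_queue Q" "regular_evaluation Q"
  shows "\<exists>l\<in>{0..max_rate Q}. R_tilde Q c = revenue Q l - l * c \<and>
           (\<forall>l'\<in>{0..max_rate Q}. revenue Q l' - l' * c \<le> revenue Q l - l * c)"
proof -
  have "continuous_on {0..max_rate Q} (\<lambda>l. revenue Q l - l * c)"
    using assms(2) by (auto simp: regular_evaluation_def intro!: continuous_intros)
  moreover have "{0..max_rate Q} \<noteq> {}"
    using assms(1) by (auto simp: valid_queue_def)
  ultimately obtain l where l: "l \<in> {0..max_rate Q}"
      "\<forall>l'\<in>{0..max_rate Q}. revenue Q l' - l' * c \<le> revenue Q l - l * c"
    using continuous_attains_sup[OF compact_Icc] by blast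
  then show ?thesis
    unfolding R_tilde_def
    using SUP_eqI_max[of l "{0..max_rate Q}" "\<lambda>l. revenue Q l - l * c"] by auto
qed

lemma summable_weight_max_rate:
  assumes "valid_queue Q"
  shows "summable (weight Q (\<lambda>_. max_rate Q))"
proof -
  obtain n0 :: nat where n0: "real n0 * abandon_q Q \<ge> 2 * max_rate Q"
    using reals_Archimedean3[of "abandon_q Q"] assms by (meson less_eq_real_def valid_queue_def)
  have "norm (weight Q (\<lambda>_. max_rate Q) (Suc n)) \<le> 1/2 * norm (weight Q (\<lambda>_. max_rate Q) n)"
    if "n \<ge> n0 + servers Q" for n
  proof -
    have pos: "departure_rate Q (Suc n) > 0"
      using departure_rate_pos[OF assms] by simp
    have "2 * max_rate Q \<le> real (Suc n - servers Q) * abandon_q Q"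
      using n0 that assms by (intro order_trans[OF n0] mult_right_mono) (auto simp: valid_queue_def)
    also have "\<dots> \<le> departure_rate Q (Suc n)"
      unfolding departure_rate_def using assms by (auto simp: valid_queue_def)
    finally have "max_rate Q / departure_rate Q (Suc n) \<le> 1/2"
      using pos by (simp add: field_simps)
    moreover have "max_rate Q / departure_rate Q (Suc n) \<ge> 0"
      using pos assms by (auto simp: valid_queue_def)
    ultimately have "\<bar>max_rate Q / departure_rate Q (Suc n)\<bar> \<le> 1/2" by simp
    then have "norm (weight Q (\<lambda>_. max_rate Q) n) * \<bar>max_rate Q / departure_rate Q (Suc n)\<bar>
        \<le> norm (weight Q (\<lambda>_. max_rate Q) n) * (1/2)"
      by (rule mult_left_mono) simp
    then show ?thesis
      by (simp add: weight_def abs_mult mult.commute)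
  qed
  then show ?thesis
    by (rule summable_ratio_test[rotated]) auto
qed

end

theory Submission
  imports Defs
begin

text \<open>
  The idea is to charge holding and abandonment costs to customers on arrival instead of over time.
  A job in service costs \<open>\<C>\<^sub>s\<close> per unit of its departure rate and a waiting job costs \<open>\<C>\<^sub>q\<close> per unit
  of its departure rate. In steady state the flow \<open>\<lambda>\<^sub>n P\<^sub>n\<close> into state \<open>n + 1\<close> balances the flow
  \<open>\<gamma>\<^sub>n\<^sub>+\<^sub>1 P\<^sub>n\<^sub>+\<^sub>1\<close> out of it, so the cost of the departures can be moved to the arrivals: an
  arrival that finds a free server is charged \<open>\<C>\<^sub>s\<close>, one that finds all servers busy is charged
  \<open>\<C>\<^sub>q\<close>, and there remains to subtract a correction \<open>(\<C>\<^sub>s - \<C>\<^sub>q) \<gamma>\<^sub>m P(n > m)\<close>, since in the states above \<open>m\<close>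
  the servers still work at the rate \<open>\<gamma>\<^sub>m\<close> (\<open>gain_charged_on_arrival\<close>). The correction has the sign
  of \<open>\<C>\<^sub>s - \<C>\<^sub>q\<close>, and by flow balance \<open>\<gamma>\<^sub>m P(n > m)\<close> lies between \<open>0\<close> and the flow of
  arrivals that have to wait (\<open>busy_departures_le_waiting_arrivals\<close>).

  This one identity gives both directions. The static policy with rates \<open>\<delta>\<^sub>s\<close> and \<open>\<delta>\<^sub>q\<close> earns
  exactly \<open>R\<^sub>s\<close> per unit time below \<open>m\<close>, \<open>R\<^sub>q\<close> from \<open>m\<close> to \<open>N - 1\<close>, and nothing in state \<open>N\<close>, up to
  the correction; and it is one of the two-price policies. For an arbitrary policy the charged
  revenue rate is at most \<open>R\<^sub>s\<close>, respectively \<open>R\<^sub>q\<close>. If \<open>\<C>\<^sub>s \<le> \<C>\<^sub>q\<close>, the correction at most turns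
  the charge \<open>\<C>\<^sub>q\<close> back into \<open>\<C>\<^sub>s\<close>, and the gain is at most \<open>R\<^sub>s\<close>. If \<open>\<C>\<^sub>s \<ge> \<C>\<^sub>q\<close>, the correction is
  a loss, so the gain is at most \<open>R\<^sub>s + (R\<^sub>q - R\<^sub>s) P(n \<ge> m)\<close>, and \<open>P(n \<ge> m)\<close> is largest when every
  arrival is admitted at the full rate and the buffer is unlimited (\<open>busy_prob_le_PqLambda\<close>).
\<close>

section \<open>Flow balance in steady state\<close>

lemma policies_bounds:
  assumes "valid_queue Q" "l \<in> policies Q"
  shows "0 \<le> l n" "l n \<le> max_rate Q"
  using assms by (cases "n < capacity Q"; auto simp: policies_def valid_queue_def)+

lemma weight_nonneg:
  assumes "valid_queue Q" "\<And>n. 0 \<le> l n"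
  shows "0 \<le> weight Q l n"
  unfolding weight_def using departure_rate_pos[OF assms(1)] assms(2)
  by (intro prod_nonneg) (auto intro!: divide_nonneg_pos)

lemma steady_prob_nonneg:
  assumes "valid_queue Q" "l \<in> policies Q"
  shows "0 \<le> steady_prob Q l n"
  unfolding steady_prob_def
  using weight_nonneg[OF assms(1) policies_bounds(1)[OF assms]] weight_sum_pos[OF assms]
  by (simp add: divide_nonneg_pos)

lemma sum_steady_prob:
  assumes "valid_queue Q" "l \<in> policies Q"
  shows "(\<Sum>n=0..capacity Q. steady_prob Q l n) = 1"
  using weight_sum_pos[OF assms] by (simp add: steady_prob_def flip: sum_divide_distrib)

lemma sum_states_split:
  fixes f :: "nat \<Rightarrow> real"
  assumes "m \<le> N"
  shows "(\<Sum>n=0..N. f n) = (\<Sum>n<m. f n) + (\<Sum>n=m..<N. f n) + f N"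
proof -
  have "(\<Sum>n=0..N. f n) = (\<Sum>n=0..<N. f n) + f N"
    using sum.last_plus[of 0 N f] by simp
  also have "(\<Sum>n=0..<N. f n) = (\<Sum>n<m. f n) + (\<Sum>n=m..<N. f n)"
    using sum.atLeastLessThan_concat[of 0 m N f] assms by (simp add: atLeast0LessThan)
  finally show ?thesis .
qed

lemma flow_balance:
  assumes "valid_queue Q"
  shows "departure_rate Q (Suc n) * steady_prob Q l (Suc n) = l n * steady_prob Q l n"
  using departure_rate_pos[OF assms, of "Suc n"]
  by (simp add: steady_prob_def weight_def field_simps)

lemma arrivals_eq_departures:
  assumes "valid_queue Q"
  shows "(\<Sum>n=i..<k. l n * steady_prob Q l n)
    = (\<Sum>n=Suc i..<Suc k. departure_rate Q n * steady_prob Q l n)"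
  by (simp only: sum.shift_bounds_Suc_ivl flow_balance[OF assms])

lemma departure_rate_servers:
  "departure_rate Q (servers Q) = real (servers Q) * (service_rate Q + abandon_s Q)"
  by (simp add: departure_rate_def)

lemma departure_rate_servers_le:
  assumes "valid_queue Q" "servers Q \<le> n"
  shows "departure_rate Q (servers Q) \<le> departure_rate Q n"
  using assms by (auto simp: departure_rate_def valid_queue_def)

text \<open>Every departure from a state above \<open>m\<close> balances an arrival that found all servers busy,
  and among those departures only the ones at rate \<open>\<gamma>\<^sub>m\<close> come from the servers.\<close>

lemma busy_departures_le_waiting_arrivals:
  assumes "valid_queue Q" "l \<in> policies Q"
  shows "departure_rate Q (servers Q) * (\<Sum>n=Suc (servers Q)..<Suc (capacity Q). steady_prob Q l n)
    \<le> (\<Sum>n=servers Q..<capacity Q. l n * steady_prob Q l n)"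
  unfolding arrivals_eq_departures[OF assms(1)] sum_distrib_left
  by (intro sum_mono mult_right_mono steady_prob_nonneg[OF assms]
      departure_rate_servers_le[OF assms(1)]) auto

section \<open>The gain with costs charged on arrival\<close>

text \<open>Per unit of its departure rate, a job in service costs \<open>\<C>\<^sub>s\<close> and a waiting job \<open>\<C>\<^sub>q\<close>.
  Above \<open>m\<close> the jobs in service contribute \<open>\<gamma>\<^sub>m\<close> to \<open>\<gamma>\<^sub>n\<close>; they are first charged \<open>\<C>\<^sub>q\<close> and then
  corrected, because flow balance controls only the total rate \<open>\<gamma>\<^sub>n\<close>.\<close>

lemma gain_rate_eq:
  assumes "valid_queue Q"
  shows "gain_rate Q n x = revenue Q x
    - (if n \<le> servers Q then cost_s Q * departure_rate Q n
       else cost_q Q * departure_rate Q n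
            + (cost_s Q - cost_q Q) * departure_rate Q (servers Q))"
proof -
  have s: "cost_s Q * (service_rate Q + abandon_s Q) = hold_cost Q + abandon_cost_s Q * abandon_s Q"
    using assms by (auto simp: cost_s_def valid_queue_def)
  have q: "cost_q Q * abandon_q Q = hold_cost Q + abandon_cost_q Q * abandon_q Q"
    using assms by (auto simp: cost_q_def valid_queue_def field_simps)
  show ?thesis
  proof (cases "n \<le> servers Q")
    case True
    then have "cost_s Q * departure_rate Q n
        = real n * (cost_s Q * (service_rate Q + abandon_s Q))"
      by (simp add: departure_rate_def)
    also have "\<dots> = real n * (hold_cost Q + abandon_cost_s Q * abandon_s Q)"
      by (simp only: s)
    finally show ?thesis
      using True by (simp add: gain_rate_def algebra_simps)
  next
    case False
    then have n: "real n = real (servers Q) + real (n - servers Q)" and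
      min: "min n (servers Q) = servers Q"
      by auto
    have "cost_q Q * departure_rate Q n
          + (cost_s Q - cost_q Q) * departure_rate Q (servers Q)
        = real (servers Q) * (cost_s Q * (service_rate Q + abandon_s Q))
          + real (n - servers Q) * (cost_q Q * abandon_q Q)"
      unfolding departure_rate_servers unfolding departure_rate_def min
      by (simp add: algebra_simps)
    also have "\<dots> = real (servers Q) * (hold_cost Q + abandon_cost_s Q * abandon_s Q)
          + real (n - servers Q) * (hold_cost Q + abandon_cost_q Q * abandon_q Q)"
      by (simp only: s q)
    finally show ?thesis
      using False unfolding gain_rate_def min n by (simp add: algebra_simps)
  qed
qed

lemma gain_charged_on_arrival:
  assumes "valid_queue Q" "l \<in> policies Q"
  shows "gain Q l
    = (\<Sum>n<servers Q. (revenue Q (l n) - l n * cost_s Q) * steady_prob Q l n)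
      + (\<Sum>n=servers Q..<capacity Q. (revenue Q (l n) - l n * cost_q Q) * steady_prob Q l n)
      - (cost_s Q - cost_q Q)
        * (departure_rate Q (servers Q)
           * (\<Sum>n=Suc (servers Q)..<Suc (capacity Q). steady_prob Q l n))"
proof -
  define m N P \<gamma> where "m = servers Q" and "N = capacity Q" and "P = steady_prob Q l"
    and "\<gamma> = departure_rate Q"
  define c where "c n = (if n \<le> m then cost_s Q * \<gamma> n
      else cost_q Q * \<gamma> n + (cost_s Q - cost_q Q) * \<gamma> m)" for n
  have mN: "m \<le> N"
    using assms(1) by (simp add: m_def N_def valid_queue_def)
  have "revenue Q (l N) = 0"
    using assms(2) by (simp add: N_def policies_def revenue_def)
  moreover have "gain Q l = (\<Sum>n=0..N. revenue Q (l n) * P n) - (\<Sum>n=0..N. c n * P n)"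
    unfolding gain_def gain_rate_eq[OF assms(1)] c_def m_def N_def P_def \<gamma>_def
    by (simp add: left_diff_distrib sum_subtractf)
  ultimately have gain: "gain Q l = (\<Sum>n<m. revenue Q (l n) * P n)
      + (\<Sum>n=m..<N. revenue Q (l n) * P n) - (\<Sum>n=0..N. c n * P n)"
    using sum_states_split[OF mN, of "\<lambda>n. revenue Q (l n) * P n"] by simp
  \<comment> \<open>The empty system costs nothing, so the cost sums start in state \<open>1\<close> and each state is matched
    with the one below it, from which it is entered.\<close>
  have "c 0 = 0"
    by (simp add: c_def \<gamma>_def departure_rate_def)
  then have "(\<Sum>n=0..N. c n * P n) = (\<Sum>n=Suc 0..<Suc N. c n * P n)"
    by (simp add: sum.atLeast_Suc_atMost atLeastLessThanSuc_atLeastAtMost)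
  also have "\<dots> = (\<Sum>n=Suc 0..<Suc m. c n * P n) + (\<Sum>n=Suc m..<Suc N. c n * P n)"
    using mN by (intro sum.atLeastLessThan_concat[symmetric]) auto
  also have "(\<Sum>n=Suc 0..<Suc m. c n * P n) = cost_s Q * (\<Sum>n=Suc 0..<Suc m. \<gamma> n * P n)"
    unfolding sum_distrib_left by (intro sum.cong) (auto simp: c_def)
  also have "\<dots> = cost_s Q * (\<Sum>n<m. l n * P n)"
    unfolding \<gamma>_def P_def arrivals_eq_departures[OF assms(1), symmetric]
    by (simp add: atLeast0LessThan)
  also have "(\<Sum>n=Suc m..<Suc N. c n * P n)
      = cost_q Q * (\<Sum>n=Suc m..<Suc N. \<gamma> n * P n)
        + (cost_s Q - cost_q Q) * (\<gamma> m * (\<Sum>n=Suc m..<Suc N. P n))"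
    unfolding sum_distrib_left sum.distrib[symmetric]
    by (intro sum.cong) (auto simp: c_def algebra_simps)
  also have "(\<Sum>n=Suc m..<Suc N. \<gamma> n * P n) = (\<Sum>n=m..<N. l n * P n)"
    unfolding \<gamma>_def P_def by (rule arrivals_eq_departures[OF assms(1), symmetric])
  finally have costs: "(\<Sum>n=0..N. c n * P n) = cost_s Q * (\<Sum>n<m. l n * P n)
      + (cost_q Q * (\<Sum>n=m..<N. l n * P n)
         + (cost_s Q - cost_q Q) * (\<gamma> m * (\<Sum>n=Suc m..<Suc N. P n)))" .
  have charge: "(\<Sum>n\<in>A. (revenue Q (l n) - l n * x) * P n)
      = (\<Sum>n\<in>A. revenue Q (l n) * P n) - x * (\<Sum>n\<in>A. l n * P n)" for A x
    by (simp add: sum_distrib_left sum_subtractf algebra_simps)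
  show ?thesis
    using gain costs charge[of "cost_s Q" "{..<m}"] charge[of "cost_q Q" "{m..<N}"]
    unfolding m_def N_def P_def \<gamma>_def by linarith
qed

section \<open>Upper bounds on the gain of an arbitrary policy\<close>

lemma charged_revenue_le_R_tilde:
  assumes "valid_queue Q" "regular_evaluation Q" "x \<in> {0..max_rate Q}"
  shows "revenue Q x - x * c \<le> R_tilde Q c"
  using R_tilde_attained[OF assms(1,2), of c] assms(3) by auto

lemma R_tilde_nonneg:
  assumes "valid_queue Q" "regular_evaluation Q"
  shows "0 \<le> R_tilde Q c"
  using charged_revenue_le_R_tilde[OF assms, of 0 c] assms(1)
  by (auto simp: revenue_def valid_queue_def)

lemma R_tilde_antimono:
  assumes "valid_queue Q" "regular_evaluation Q" "c \<le> d"
  shows "R_tilde Q d \<le> R_tilde Q c"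
proof -
  obtain x where x: "x \<in> {0..max_rate Q}" "R_tilde Q d = revenue Q x - x * d"
    using R_tilde_attained[OF assms(1,2)] by blast
  have "x * c \<le> x * d"
    using x(1) assms(3) by (intro mult_left_mono) auto
  then show ?thesis
    using charged_revenue_le_R_tilde[OF assms(1,2) x(1), of c] x(2) by linarith
qed

lemma sum_charged_revenue_le:
  assumes "valid_queue Q" "regular_evaluation Q" "l \<in> policies Q"
  shows "(\<Sum>n\<in>A. (revenue Q (l n) - l n * c) * steady_prob Q l n)
    \<le> R_tilde Q c * (\<Sum>n\<in>A. steady_prob Q l n)"
  unfolding sum_distrib_left
  using policies_bounds[OF assms(1,3)]
  by (intro sum_mono mult_right_mono steady_prob_nonneg[OF assms(1,3)]
      charged_revenue_le_R_tilde[OF assms(1,2)]) auto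

text \<open>When departures from the queue are the more expensive ones, the system can at best do as if
  every arrival were charged \<open>\<C>\<^sub>s\<close>: the correction refunds at most \<open>\<C>\<^sub>q - \<C>\<^sub>s\<close> to each arrival that waits.\<close>

lemma gain_le_R_tilde_cost_s:
  assumes "valid_queue Q" "regular_evaluation Q" "l \<in> policies Q" "cost_s Q \<le> cost_q Q"
  shows "gain Q l \<le> R_tilde Q (cost_s Q)"
proof -
  define m N P where "m = servers Q" and "N = capacity Q" and "P = steady_prob Q l"
  have mN: "m \<le> N"
    using assms(1) by (simp add: m_def N_def valid_queue_def)
  define B where "B = departure_rate Q m * (\<Sum>n=Suc m..<Suc N. P n)"
  have refund: "(cost_q Q - cost_s Q) * B \<le> (cost_q Q - cost_s Q) * (\<Sum>n=m..<N. l n * P n)"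
    using busy_departures_le_waiting_arrivals[OF assms(1,3)] assms(4)
    by (intro mult_left_mono) (auto simp: B_def m_def N_def P_def)
  have "(\<Sum>n=m..<N. (revenue Q (l n) - l n * cost_s Q) * P n)
      = (\<Sum>n=m..<N. (revenue Q (l n) - l n * cost_q Q) * P n)
        + (cost_q Q - cost_s Q) * (\<Sum>n=m..<N. l n * P n)"
    by (simp add: sum_distrib_left algebra_simps flip: sum.distrib)
  then have "gain Q l \<le> (\<Sum>n<m. (revenue Q (l n) - l n * cost_s Q) * P n)
      + (\<Sum>n=m..<N. (revenue Q (l n) - l n * cost_s Q) * P n)"
    using gain_charged_on_arrival[OF assms(1,3), folded m_def N_def P_def, folded B_def] refund
    by (simp add: algebra_simps)
  also have "\<dots> \<le> R_tilde Q (cost_s Q) * (\<Sum>n<m. P n) + R_tilde Q (cost_s Q) * (\<Sum>n=m..<N. P n)"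
    unfolding P_def by (intro add_mono sum_charged_revenue_le assms)
  also have "\<dots> \<le> R_tilde Q (cost_s Q) * ((\<Sum>n<m. P n) + (\<Sum>n=m..<N. P n) + P N)"
    using mult_nonneg_nonneg[OF R_tilde_nonneg[OF assms(1,2), of "cost_s Q"]
        steady_prob_nonneg[OF assms(1,3), of N]]
    by (simp add: P_def algebra_simps)
  also have "(\<Sum>n<m. P n) + (\<Sum>n=m..<N. P n) + P N = 1"
    using sum_steady_prob[OF assms(1,3)] sum_states_split[OF mN, of P] by (simp add: N_def P_def)
  finally show ?thesis by simp
qed

text \<open>For \<open>i \<le> n\<close> the likelihood ratio \<open>a\<^sub>n / a\<^sub>i\<close> is the product of \<open>\<lambda>\<^sub>j / \<gamma>\<^sub>j\<^sub>+\<^sub>1\<close> over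
  \<open>i \<le> j < n\<close>, hence increasing in the rates. Written without division, since rates may vanish.\<close>

lemma weight_ratio_mono:
  assumes "valid_queue Q" "\<And>n. 0 \<le> l n" "\<And>n. l n \<le> l' n" "i \<le> n"
  shows "weight Q l n * weight Q l' i \<le> weight Q l' n * weight Q l i"
  using assms(4)
proof (induction n rule: dec_induct)
  case (step n)
  define \<gamma> where "\<gamma> = departure_rate Q (Suc n)"
  have "0 < \<gamma>"
    unfolding \<gamma>_def using departure_rate_pos[OF assms(1)] by simp
  then have rate: "0 \<le> l n / \<gamma>" "l n / \<gamma> \<le> l' n / \<gamma>"
    using assms(2,3)[of n] by (auto intro: divide_right_mono)
  have l': "0 \<le> l' j" for j
    using assms(2,3)[of j] by linarith
  have Suc: "weight Q k (Suc n) = weight Q k n * (k n / \<gamma>)" for k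
    by (simp add: weight_def \<gamma>_def)
  have "(weight Q l n * weight Q l' i) * (l n / \<gamma>)
      \<le> (weight Q l' n * weight Q l i) * (l' n / \<gamma>)"
    by (intro mult_mono step.IH rate mult_nonneg_nonneg weight_nonneg[OF assms(1)] assms(2) l')
  then show ?case
    unfolding Suc by (simp only: mult_ac)
qed simp

text \<open>Summing the likelihood ratio comparison over all pairs \<open>i < m \<le> n\<close> compares the odds of
  finding all servers busy; the unlimited buffer only adds mass above \<open>m\<close>.\<close>

lemma busy_prob_le_PqLambda:
  assumes "valid_queue Q" "l \<in> policies Q"
  shows "(\<Sum>n=servers Q..<Suc (capacity Q). steady_prob Q l n) \<le> PqLambda Q"
proof -
  define m N a b where "m = servers Q" and "N = capacity Q" and "a = weight Q l"
    and "b = weight Q (\<lambda>_. max_rate Q)"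
  have mN: "1 \<le> m" "m \<le> N" and rate: "0 < max_rate Q"
    using assms(1) by (auto simp: m_def N_def valid_queue_def)
  have a: "0 \<le> a n" and b: "0 \<le> b n" for n
    using weight_nonneg[OF assms(1)] policies_bounds[OF assms] rate by (auto simp: a_def b_def)
  have sum_b: "summable b"
    unfolding b_def by (rule summable_weight_max_rate[OF assms(1)])
  then have sum_tail: "summable (\<lambda>n. b (m + n))"
    using summable_iff_shift[of b m] by (simp add: add.commute)
  define A T B U where "A = (\<Sum>n<m. a n)" and "T = (\<Sum>n=m..<Suc N. a n)"
    and "B = (\<Sum>n<m. b n)" and "U = (\<Sum>n. b (m + n))"
  have "(\<Sum>n=m..<Suc N. b n) = (\<Sum>n<Suc N - m. b (m + n))"
    by (simp only: sum.atLeastLessThan_shift_0[of b m] atLeast0LessThan comp_def)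
  also have "\<dots> \<le> U"
    unfolding U_def by (intro sum_le_suminf sum_tail) (auto simp: b)
  finally have tail: "(\<Sum>n=m..<Suc N. b n) \<le> U" .
  have "T * B = (\<Sum>n=m..<Suc N. \<Sum>i<m. a n * b i)"
    by (simp only: T_def B_def sum_product)
  also have "\<dots> \<le> (\<Sum>n=m..<Suc N. \<Sum>i<m. b n * a i)"
    unfolding a_def b_def using policies_bounds[OF assms]
    by (intro sum_mono weight_ratio_mono assms(1)) auto
  also have "\<dots> = (\<Sum>n=m..<Suc N. b n) * A"
    by (simp only: A_def sum_product)
  also have "\<dots> \<le> U * A"
    using tail by (intro mult_right_mono) (auto simp: A_def a intro: sum_nonneg)
  finally have odds: "T * B \<le> U * A" .
  have pos: "0 < A" "0 < B"
    unfolding A_def B_def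
    by (rule sum_pos2[of _ 0]; use mN a b in \<open>force simp: a_def b_def weight_def\<close>)+
  moreover have "0 \<le> T" "0 \<le> U"
    unfolding T_def U_def by (intro sum_nonneg suminf_nonneg sum_tail a b)+
  ultimately have "T / (A + T) \<le> U / (B + U)"
    using odds by (simp add: divide_simps algebra_simps)
  moreover have "(\<Sum>n=0..N. a n) = A + T"
    using sum_states_split[OF mN(2), of a] mN by (simp add: A_def T_def)
  then have "(\<Sum>n=m..<Suc N. steady_prob Q l n) = T / (A + T)"
    by (simp only: steady_prob_def T_def a_def N_def sum_divide_distrib)
  moreover have "(\<Sum>n. b n) = B + U"
    using suminf_split_initial_segment[OF sum_b, of m] by (simp add: B_def U_def add.commute)
  then have "PqLambda Q = U / (B + U)"
    by (simp add: PqLambda_def U_def b_def m_def)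
  ultimately show ?thesis
    by (simp add: m_def N_def)
qed

lemma gain_le_PqLambda_mixture:
  assumes "valid_queue Q" "regular_evaluation Q" "l \<in> policies Q" "cost_q Q \<le> cost_s Q"
  shows "gain Q l
    \<le> R_tilde Q (cost_s Q) + (R_tilde Q (cost_q Q) - R_tilde Q (cost_s Q)) * PqLambda Q"
proof -
  define m N P where "m = servers Q" and "N = capacity Q" and "P = steady_prob Q l"
  define Rs Rq where "Rs = R_tilde Q (cost_s Q)" and "Rq = R_tilde Q (cost_q Q)"
  have mN: "1 \<le> m" "m \<le> N"
    using assms(1) by (auto simp: m_def N_def valid_queue_def)
  have P: "0 \<le> P n" for n
    unfolding P_def by (rule steady_prob_nonneg[OF assms(1,3)])
  have "0 \<le> (cost_s Q - cost_q Q) * (departure_rate Q m * (\<Sum>n=Suc m..<Suc N. P n))"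
    using departure_rate_pos[OF assms(1) mN(1)] assms(4)
    by (intro mult_nonneg_nonneg sum_nonneg P) auto
  then have "gain Q l \<le> (\<Sum>n<m. (revenue Q (l n) - l n * cost_s Q) * P n)
      + (\<Sum>n=m..<N. (revenue Q (l n) - l n * cost_q Q) * P n)"
    using gain_charged_on_arrival[OF assms(1,3), folded m_def N_def P_def] by linarith
  also have "\<dots> \<le> Rs * (\<Sum>n<m. P n) + Rq * (\<Sum>n=m..<N. P n)"
    unfolding P_def Rs_def Rq_def by (intro add_mono sum_charged_revenue_le assms)
  also have "\<dots> \<le> Rs * (\<Sum>n<m. P n) + Rq * (\<Sum>n=m..<Suc N. P n)"
    using mN P[of N] R_tilde_nonneg[OF assms(1,2), of "cost_q Q"]
    by (auto simp: Rq_def intro!: mult_left_mono)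
  also have "(\<Sum>n<m. P n) = 1 - (\<Sum>n=m..<Suc N. P n)"
    using sum_steady_prob[OF assms(1,3)] sum_states_split[OF mN(2), of P] mN
    by (simp add: N_def P_def)
  also have "Rs * (1 - (\<Sum>n=m..<Suc N. P n)) + Rq * (\<Sum>n=m..<Suc N. P n)
      = Rs + (Rq - Rs) * (\<Sum>n=m..<Suc N. P n)"
    by (simp add: algebra_simps)
  also have "\<dots> \<le> Rs + (Rq - Rs) * PqLambda Q"
    using busy_prob_le_PqLambda[OF assms(1,3)] R_tilde_antimono[OF assms(1,2,4)]
    by (intro add_left_mono mult_left_mono) (auto simp: Rs_def Rq_def P_def m_def N_def)
  finally show ?thesis
    by (simp add: Rs_def Rq_def)
qed

section \<open>The gain of the static policy\<close>

text \<open>The set of maximizers is closed by continuity of the revenue, so it contains its infimum.\<close>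

lemma delta_tilde_maximizes:
  assumes "valid_queue Q" "regular_evaluation Q"
  shows "delta_tilde Q c \<in> {0..max_rate Q}"
    and "revenue Q (delta_tilde Q c) - delta_tilde Q c * c = R_tilde Q c"
proof -
  define h where "h x = revenue Q x - x * c" for x
  define M where "M = {x \<in> {0..max_rate Q}. h x = R_tilde Q c}"
  obtain x where x: "x \<in> {0..max_rate Q}" "R_tilde Q c = h x"
      "\<forall>y\<in>{0..max_rate Q}. h y \<le> h x"
    using R_tilde_attained[OF assms, of c] unfolding h_def by blast
  have "{x. is_arg_max h (\<lambda>x. x \<in> {0..max_rate Q}) x} = M"
    using x by (force simp: is_arg_max_def M_def)
  then have delta: "delta_tilde Q c = Inf M"
    by (simp add: delta_tilde_def h_def[abs_def])
  have "continuous_on {0..max_rate Q} h"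
    using assms(2) unfolding h_def regular_evaluation_def by (auto intro!: continuous_intros)
  then have "closed M"
    unfolding M_def by (rule continuous_closed_preimage_constant) simp
  moreover have "M \<noteq> {}" "bdd_below M"
    using x by (auto simp: M_def intro!: bdd_belowI[of _ 0])
  ultimately have "Inf M \<in> M"
    by (intro closed_contains_Inf)
  then show "delta_tilde Q c \<in> {0..max_rate Q}"
    and "revenue Q (delta_tilde Q c) - delta_tilde Q c * c = R_tilde Q c"
    by (auto simp: delta M_def h_def)
qed

lemma static_policy_in_policies:
  assumes "valid_queue Q" "regular_evaluation Q"
  shows "static_policy Q \<in> policies Q"
  unfolding static_policy_def
  using assms(1) by (intro two_price_in_policies delta_tilde_maximizes assms)
    (auto simp: valid_queue_def)

lemma gain_static_policy_le_opt_two_price_gain: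
  assumes "valid_queue Q" "regular_evaluation Q"
  shows "gain Q (static_policy Q) \<le> opt_two_price_gain Q"
proof -
  let ?S = "{0..max_rate Q} \<times> {0..max_rate Q}"
  have N: "capacity Q \<in> {servers Q..capacity Q}"
    using assms(1) by (auto simp: valid_queue_def)
  have "gain Q (static_policy Q) \<le> (SUP (ds, dq)\<in>?S. gain Q (two_price Q (capacity Q) ds dq))"
    using two_price_gain_attained[OF assms N] delta_tilde_maximizes(1)[OF assms]
    unfolding static_policy_def by fastforce
  also have "\<dots> \<le> opt_two_price_gain Q"
    unfolding opt_two_price_gain_def using N by (intro Max_ge) auto
  finally show ?thesis .
qed

lemma gain_static_policy:
  assumes "valid_queue Q" "regular_evaluation Q"
  shows "gain Q (static_policy Q)
    = R_tilde Q (cost_s Q) * (1 - PqT Q - PNT Q) + R_tilde Q (cost_q Q) * PqT Q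
      - (cost_s Q - cost_q Q)
        * (departure_rate Q (servers Q)
           * (\<Sum>n=Suc (servers Q)..<Suc (capacity Q). steady_prob Q (static_policy Q) n))"
proof -
  let ?l = "static_policy Q"
  let ?P = "steady_prob Q ?l"
  have pol: "?l \<in> policies Q"
    by (rule static_policy_in_policies[OF assms])
  have mN: "servers Q \<le> capacity Q"
    using assms(1) by (simp add: valid_queue_def)
  have "(\<Sum>n<servers Q. (revenue Q (?l n) - ?l n * cost_s Q) * ?P n)
      = (\<Sum>n<servers Q. R_tilde Q (cost_s Q) * ?P n)"
    using delta_tilde_maximizes(2)[OF assms]
    by (intro sum.cong) (auto simp: static_policy_def two_price_def)
  also have "\<dots> = R_tilde Q (cost_s Q) * (\<Sum>n<servers Q. ?P n)"
    by (simp add: sum_distrib_left)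
  also have "(\<Sum>n<servers Q. ?P n) = 1 - PqT Q - PNT Q"
    using sum_steady_prob[OF assms(1) pol] sum_states_split[OF mN, of ?P]
    by (simp add: PqT_def PNT_def)
  finally have below: "(\<Sum>n<servers Q. (revenue Q (?l n) - ?l n * cost_s Q) * ?P n)
      = R_tilde Q (cost_s Q) * (1 - PqT Q - PNT Q)" .
  have "(\<Sum>n=servers Q..<capacity Q. (revenue Q (?l n) - ?l n * cost_q Q) * ?P n)
      = R_tilde Q (cost_q Q) * PqT Q"
    unfolding PqT_def sum_distrib_left
    using delta_tilde_maximizes(2)[OF assms]
    by (intro sum.cong) (auto simp: static_policy_def two_price_def)
  with below show ?thesis
    using gain_charged_on_arrival[OF assms(1) pol] by simp
qed

lemma static_busy_departures_le:
  assumes "valid_queue Q" "regular_evaluation Q"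
  shows "departure_rate Q (servers Q)
      * (\<Sum>n=Suc (servers Q)..<Suc (capacity Q). steady_prob Q (static_policy Q) n)
    \<le> delta_tilde Q (cost_q Q) * PqT Q"
proof -
  have "(\<Sum>n=servers Q..<capacity Q. static_policy Q n * steady_prob Q (static_policy Q) n)
      = delta_tilde Q (cost_q Q) * PqT Q"
    unfolding PqT_def sum_distrib_left
    by (intro sum.cong) (auto simp: static_policy_def two_price_def)
  then show ?thesis
    using busy_departures_le_waiting_arrivals[OF assms(1) static_policy_in_policies[OF assms]]
    by simp
qed

section \<open>The performance guarantee\<close>

theorem theorem5p4:
  fixes Q :: queue
  assumes "valid_queue Q"
    and "regular_evaluation Q"
  shows "(cost_s Q \<le> cost_q Q \<longrightarrow>
            opt_gain Q - opt_two_price_gain Q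
              \<le> (R_tilde Q (cost_s Q) - R_tilde Q (cost_q Q)) * PqT Q + R_tilde Q (cost_s Q) * PNT Q)
       \<and> (cost_s Q \<ge> cost_q Q \<longrightarrow>
            opt_gain Q - opt_two_price_gain Q
              \<le> (R_tilde Q (cost_q Q) - R_tilde Q (cost_s Q)) * (PqLambda Q - PqT Q)
                + delta_tilde Q (cost_q Q) * (cost_s Q - cost_q Q) * PqT Q
                + R_tilde Q (cost_s Q) * PNT Q)"
proof -
  define B where "B = departure_rate Q (servers Q)
      * (\<Sum>n=Suc (servers Q)..<Suc (capacity Q). steady_prob Q (static_policy Q) n)"
  obtain l where l: "l \<in> policies Q" "opt_gain Q = gain Q l"
    using opt_gain_attained[OF assms] by blast
  note static = gain_static_policy_le_opt_two_price_gain[OF assms]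
    gain_static_policy[OF assms, folded B_def]
  have B_nonneg: "0 \<le> B"
    unfolding B_def using departure_rate_pos[OF assms(1), of "servers Q"] assms(1)
    by (intro mult_nonneg_nonneg sum_nonneg steady_prob_nonneg static_policy_in_policies assms)
      (auto simp: valid_queue_def)
  have B_le: "B \<le> delta_tilde Q (cost_q Q) * PqT Q"
    unfolding B_def by (rule static_busy_departures_le[OF assms])
  show ?thesis
  proof (intro conjI impI)
    assume le: "cost_s Q \<le> cost_q Q"
    have "(cost_s Q - cost_q Q) * B \<le> 0"
      using le B_nonneg by (simp add: mult_nonpos_nonneg)
    then show "opt_gain Q - opt_two_price_gain Q
        \<le> (R_tilde Q (cost_s Q) - R_tilde Q (cost_q Q)) * PqT Q + R_tilde Q (cost_s Q) * PNT Q"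
      using gain_le_R_tilde_cost_s[OF assms l(1) le] l(2) static
      by (simp add: algebra_simps)
  next
    assume ge: "cost_s Q \<ge> cost_q Q"
    have "(cost_s Q - cost_q Q) * B
        \<le> (cost_s Q - cost_q Q) * (delta_tilde Q (cost_q Q) * PqT Q)"
      using ge B_le by (intro mult_left_mono) auto
    then show "opt_gain Q - opt_two_price_gain Q
        \<le> (R_tilde Q (cost_q Q) - R_tilde Q (cost_s Q)) * (PqLambda Q - PqT Q)
          + delta_tilde Q (cost_q Q) * (cost_s Q - cost_q Q) * PqT Q
          + R_tilde Q (cost_s Q) * PNT Q"
      using gain_le_PqLambda_mixture[OF assms l(1) ge] l(2) static
      by (simp add: algebra_simps)
  qed
qed

end
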